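(* Let $\mathfrak g=\mathrm{Lie}(\mathbb R\ltimes\mathbb H_3)$ be the real diamond Lie algebra and let $\alpha,\beta,\gamma,\delta\in\mathbb R$. For $A=aX+bY+cZ+dT\in\mathfrak g$ consider the differential operators acting on functions $f\in C_0^\infty(\mathbb R^2)$ of the variables $(s,t)$: $$\begin{aligned} \hat\ell_A^{(2)}&=d\,\partial_s+ia\alpha e^{-s} && (\alpha\neq0,\ \beta=\gamma=0),\\ \hat\ell_A^{(3)}&=d\,\partial_s+ib\beta e^{s} && (\beta\ne0,\ \alpha=\gamma=0),\\ \hat\ell_A^{(4)}&=d\,\partial_s+i\big[a\alpha e^{-s}+b\beta e^{s}\big] && (\alpha\beta\neq0,\ \gamma=0),\\ \hat\ell_A^{(5)}&=(d+b\gamma e^{s})\partial_s+i\big[ae^{-s}+b(\alpha\beta-\gamma\delta)e^{s}+c\gamma\big] && (\gamma\neq0),\\ \hat\ell_A^{(5')}&=(d-b\gamma e^{s})\partial_s+i\big[-ae^{-s}-b(\alpha\beta-\gamma\delta)e^{s}+c\gamma\big] && (\gamma\ne0). \end{aligned}$$ Each of these families $A\mapsto\hat\ell_A$ provides a representation of the Lie algebra $\mathfrak g$. In particular, for each family and all $A,B\in\mathfrak g$, $$\hat\ell_A\circ\hat\ell_B-\hat\ell_B\circ\hat\ell_A=\hat\ell_{[A,B]}.$$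
   Context: The real diamond Lie algebra $\mathfrak g$ is the 4-dimensional real Lie algebra with basis $X,Y,Z,T$ and brackets $[X,Y]=Z$, $[T,X]=-X$, $[T,Y]=Y$, $[Z,X]=[Z,Y]=[T,Z]=0$. The numbers $\alpha,\beta,\gamma,\delta$ are the coordinates of a functional $F=\alpha X^*+\beta Y^*+\gamma Z^*+\delta T^*\in\mathfrak g^*$. The variables are $s=q-\frac x2$, $t=q+\frac x2$ with $(x,q)\in\mathbb R^2$, so $\partial_s=\frac12\partial_q-\partial_x$. The superscripts $(2),\dots,(5')$ label the types of 2-dimensional co-adjoint orbits. *)

theory Defs
  imports "HOL-Analysis.Analysis" "HOL-Library.Function_Algebras"
begin

section \<open>Real Lie algebras and their representations on complex vector spaces\<close>

locale real_lie_algebra =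
  fixes br :: "'g::real_vector \<Rightarrow> 'g \<Rightarrow> 'g"
  assumes bilinear_br: "bilinear br"
    and br_self: "br A A = 0"
    and jacobi: "br A (br B C) + br B (br C A) + br C (br A B) = 0"

text \<open>
  The representation space is a complex subspace \<open>V\<close> of an ambient complex vector space, and each
  \<open>\<rho> A\<close> is only constrained on \<open>V\<close>.
\<close>

locale lie_representation =
  real_lie_algebra br + vector_space scale
  for br :: "'g::real_vector \<Rightarrow> 'g \<Rightarrow> 'g"
    and scale :: "complex \<Rightarrow> 'v::ab_group_add \<Rightarrow> 'v" +
  fixes V :: "'v set"
    and \<rho> :: "'g \<Rightarrow> 'v \<Rightarrow> 'v"
  assumes subspace_V: "subspace V"
    and maps_to: "f \<in> V \<Longrightarrow> \<rho> A f \<in> V"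
    and op_add: "f \<in> V \<Longrightarrow> g \<in> V \<Longrightarrow> \<rho> A (f + g) = \<rho> A f + \<rho> A g"
    and op_scale: "f \<in> V \<Longrightarrow> \<rho> A (scale z f) = scale z (\<rho> A f)"
    and rep_add: "f \<in> V \<Longrightarrow> \<rho> (A + B) f = \<rho> A f + \<rho> B f"
    and rep_scaleR: "f \<in> V \<Longrightarrow> \<rho> (r *\<^sub>R A) f = scale (complex_of_real r) (\<rho> A f)"
    and rep_bracket: "f \<in> V \<Longrightarrow> \<rho> A (\<rho> B f) - \<rho> B (\<rho> A f) = \<rho> (br A B) f"

section \<open>The real diamond Lie algebra\<close>

text \<open>\<open>(a, b, c, d)\<close> stands for \<open>aX + bY + cZ + dT\<close>.\<close>

type_synonym diamond = "real \<times> real \<times> real \<times> real"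

definition dX :: diamond where "dX = (1, 0, 0, 0)"
definition dY :: diamond where "dY = (0, 1, 0, 0)"
definition dZ :: diamond where "dZ = (0, 0, 1, 0)"
definition dT :: diamond where "dT = (0, 0, 0, 1)"

fun diamond_bracket :: "diamond \<Rightarrow> diamond \<Rightarrow> diamond" where
  "diamond_bracket (a, b, c, d) (a', b', c', d') =
     (d' * a - d * a', d * b' - d' * b, a * b' - a' * b, 0)"

lemma diamond_basis: "(a, b, c, d) = a *\<^sub>R dX + b *\<^sub>R dY + c *\<^sub>R dZ + d *\<^sub>R dT"
  by (simp add: dX_def dY_def dZ_def dT_def)

lemma diamond_bracket_basis:
  "diamond_bracket dX dY = dZ"
  "diamond_bracket dT dX = - dX"
  "diamond_bracket dT dY = dY"
  "diamond_bracket dZ dX = 0"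
  "diamond_bracket dZ dY = 0"
  "diamond_bracket dT dZ = 0"
  by (simp_all add: dX_def dY_def dZ_def dT_def zero_prod_def)

lemma real_lie_algebra_diamond: "real_lie_algebra diamond_bracket"
proof
  show "bilinear diamond_bracket"
    unfolding bilinear_def
    by (auto intro!: linearI simp: algebra_simps)
  show "diamond_bracket A A = 0" for A
    by (cases A) (simp add: zero_prod_def)
  show "diamond_bracket A (diamond_bracket B C) + diamond_bracket B (diamond_bracket C A)
      + diamond_bracket C (diamond_bracket A B) = 0" for A B C
    by (cases A; cases B; cases C) (simp add: zero_prod_def algebra_simps)
qed

section \<open>Smooth compactly supported complex-valued functions\<close>

fun k_times_cont_diff :: "nat \<Rightarrow> ('a::real_normed_vector \<Rightarrow> 'b::real_normed_vector) \<Rightarrow> bool" where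
  "k_times_cont_diff 0 f \<longleftrightarrow> continuous_on UNIV f"
| "k_times_cont_diff (Suc k) f \<longleftrightarrow>
     (\<forall>x. f differentiable (at x)) \<and>
     (\<forall>v. k_times_cont_diff k (\<lambda>x. frechet_derivative f (at x) v))"

definition smooth :: "('a::real_normed_vector \<Rightarrow> 'b::real_normed_vector) \<Rightarrow> bool" where
  "smooth f \<longleftrightarrow> (\<forall>k. k_times_cont_diff k f)"

definition test_functions :: "(real \<times> real \<Rightarrow> complex) set" where
  "test_functions = {f. smooth f \<and> compact (closure (support_on UNIV f))}"

definition fscale :: "complex \<Rightarrow> ('p \<Rightarrow> complex) \<Rightarrow> 'p \<Rightarrow> complex" where
  "fscale z f = (\<lambda>p. z * f p)"

lemma vector_space_fscale: "vector_space fscale"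
  by unfold_locales (auto simp: fscale_def fun_eq_iff algebra_simps)

section \<open>The differential operators\<close>

text \<open>Functions of \<open>(s, t)\<close>; \<open>partial_s\<close> differentiates in \<open>s\<close> with \<open>t\<close> fixed.\<close>

definition partial_s :: "(real \<times> real \<Rightarrow> complex) \<Rightarrow> real \<times> real \<Rightarrow> complex" where
  "partial_s f = (\<lambda>(s, t). vector_derivative (\<lambda>u. f (u, t)) (at s))"

text \<open>
  With \<open>s = q - x/2\<close> and \<open>t = q + x/2\<close>, \<open>partial_s\<close> is \<open>(1/2) \<partial>\<^sub>q - \<partial>\<^sub>x\<close>.
\<close>

lemma partial_s_eq:
  fixes f :: "real \<times> real \<Rightarrow> complex"
  assumes "f differentiable (at (q - x / 2, q + x / 2))"
  shows "partial_s f (q - x / 2, q + x / 2) =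
      (1 / 2) * vector_derivative (\<lambda>q. f (q - x / 2, q + x / 2)) (at q)
      - vector_derivative (\<lambda>x. f (q - x / 2, q + x / 2)) (at x)"
proof -
  let ?p = "(q - x / 2, q + x / 2)"
  obtain D where D: "(f has_derivative D) (at ?p)"
    using assms unfolding differentiable_def by blast
  then interpret D: bounded_linear D by (rule has_derivative_bounded_linear)
  have 1: "((\<lambda>u. f (u, q + x / 2)) has_vector_derivative D (1, 0)) (at (q - x / 2))"
    unfolding has_vector_derivative_def
    by (rule has_derivative_eq_rhs[OF has_derivative_compose[where g = f and g' = D]])
       (auto intro!: derivative_eq_intros D simp: D.scaleR[symmetric])
  have 2: "((\<lambda>q. f (q - x / 2, q + x / 2)) has_vector_derivative D (1, 1)) (at q)"
    unfolding has_vector_derivative_def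
    by (rule has_derivative_eq_rhs[OF has_derivative_compose[where g = f and g' = D]])
       (auto intro!: derivative_eq_intros D simp: D.scaleR[symmetric])
  have 3: "((\<lambda>x. f (q - x / 2, q + x / 2)) has_vector_derivative D (- 1 / 2, 1 / 2)) (at x)"
    unfolding has_vector_derivative_def
    by (rule has_derivative_eq_rhs[OF has_derivative_compose[where g = f and g' = D]])
       (auto intro!: derivative_eq_intros D simp: D.scaleR[symmetric])
  have "D (1, 0) = D ((1 / 2) *\<^sub>R (1, 1) - (- 1 / 2, 1 / 2))"
    by simp
  also have "\<dots> = (1 / 2) * D (1, 1) - D (- 1 / 2, 1 / 2)"
    unfolding D.diff D.scaleR by (simp add: scaleR_conv_of_real)
  finally show ?thesis
    using 1 2 3 by (simp add: partial_s_def vector_derivative_at)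
qed

fun ell2 :: "real \<Rightarrow> diamond \<Rightarrow> (real \<times> real \<Rightarrow> complex) \<Rightarrow> real \<times> real \<Rightarrow> complex" where
  "ell2 \<alpha> (a, b, c, d) f = (\<lambda>(s, t).
     complex_of_real d * partial_s f (s, t)
     + \<i> * complex_of_real (a * \<alpha> * exp (- s)) * f (s, t))"

fun ell3 :: "real \<Rightarrow> diamond \<Rightarrow> (real \<times> real \<Rightarrow> complex) \<Rightarrow> real \<times> real \<Rightarrow> complex" where
  "ell3 \<beta> (a, b, c, d) f = (\<lambda>(s, t).
     complex_of_real d * partial_s f (s, t)
     + \<i> * complex_of_real (b * \<beta> * exp s) * f (s, t))"

fun ell4 :: "real \<Rightarrow> real \<Rightarrow> diamond \<Rightarrow> (real \<times> real \<Rightarrow> complex) \<Rightarrow> real \<times> real \<Rightarrow> complex" where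
  "ell4 \<alpha> \<beta> (a, b, c, d) f = (\<lambda>(s, t).
     complex_of_real d * partial_s f (s, t)
     + \<i> * complex_of_real (a * \<alpha> * exp (- s) + b * \<beta> * exp s) * f (s, t))"

fun ell5 :: "real \<Rightarrow> real \<Rightarrow> real \<Rightarrow> real \<Rightarrow> diamond \<Rightarrow>
    (real \<times> real \<Rightarrow> complex) \<Rightarrow> real \<times> real \<Rightarrow> complex" where
  "ell5 \<alpha> \<beta> \<gamma> \<delta> (a, b, c, d) f = (\<lambda>(s, t).
     complex_of_real (d + b * \<gamma> * exp s) * partial_s f (s, t)
     + \<i> * complex_of_real (a * exp (- s) + b * (\<alpha> * \<beta> - \<gamma> * \<delta>) * exp s + c * \<gamma>) * f (s, t))"

fun ell5' :: "real \<Rightarrow> real \<Rightarrow> real \<Rightarrow> real \<Rightarrow> diamond \<Rightarrow>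
    (real \<times> real \<Rightarrow> complex) \<Rightarrow> real \<times> real \<Rightarrow> complex" where
  "ell5' \<alpha> \<beta> \<gamma> \<delta> (a, b, c, d) f = (\<lambda>(s, t).
     complex_of_real (d - b * \<gamma> * exp s) * partial_s f (s, t)
     + \<i> * complex_of_real (- a * exp (- s) - b * (\<alpha> * \<beta> - \<gamma> * \<delta>) * exp s + c * \<gamma>) * f (s, t))"

end

(*
  All five families have the form P d/ds + M with
    P = d + b p e^s,   M = i (a u e^-s + b v e^s + c p u),
  for suitable real constants p, u, v. The commutator of P d/ds + M and Q d/ds + N is
  (P Q' - Q P') d/ds + (P N' - Q M'), so the bracket relation becomes an identity between the
  exponential coefficients; the coefficient p u of c is forced by [X, Y] = Z.
*)
theory Submission
  imports Defs
begin

section \<open>Closure properties of smooth functions\<close>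

lemma k_times_cont_diff_Suc_imp:
  "k_times_cont_diff (Suc k) f \<Longrightarrow> k_times_cont_diff k f"
proof (induction k arbitrary: f)
  case 0
  then show ?case
    by (auto simp: continuous_on_eq_continuous_at intro: differentiable_imp_continuous_within)
next
  case (Suc k)
  from Suc.prems have "\<forall>x. f differentiable (at x)"
    and "\<forall>v. k_times_cont_diff (Suc k) (\<lambda>x. frechet_derivative f (at x) v)"
    by (auto simp only: k_times_cont_diff.simps(2)[of "Suc k" f])
  with Suc.IH show ?case
    by auto
qed

lemma k_times_cont_diff_const [simp]: "k_times_cont_diff k (\<lambda>x. c)"
proof (induction k arbitrary: c)
  case (Suc k)
  then show ?case
    by (simp add: frechet_derivative_const)
qed simp

lemma frechet_derivative_add:
  assumes "f differentiable (at x)" "g differentiable (at x)"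
  shows "frechet_derivative (\<lambda>x. f x + g x) (at x) v =
    frechet_derivative f (at x) v + frechet_derivative g (at x) v"
proof -
  have "((\<lambda>x. f x + g x) has_derivative
      (\<lambda>v. frechet_derivative f (at x) v + frechet_derivative g (at x) v)) (at x)"
    using assms by (intro has_derivative_add) (auto simp: frechet_derivative_works)
  from frechet_derivative_at[OF this] show ?thesis
    by metis
qed

lemma k_times_cont_diff_add:
  "k_times_cont_diff k f \<Longrightarrow> k_times_cont_diff k g \<Longrightarrow> k_times_cont_diff k (\<lambda>x. f x + g x)"
proof (induction k arbitrary: f g)
  case 0
  then show ?case by (simp add: continuous_on_add)
next
  case (Suc k)
  then have "frechet_derivative (\<lambda>x. f x + g x) (at x) v =
      frechet_derivative f (at x) v + frechet_derivative g (at x) v" for x v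
    by (simp add: frechet_derivative_add)
  with Suc show ?case
    by (simp add: differentiable_add)
qed

lemma frechet_derivative_mult:
  fixes f g :: "'a::real_normed_vector \<Rightarrow> 'b::real_normed_algebra"
  assumes "f differentiable (at x)" "g differentiable (at x)"
  shows "frechet_derivative (\<lambda>x. f x * g x) (at x) v =
    f x * frechet_derivative g (at x) v + frechet_derivative f (at x) v * g x"
proof -
  have "((\<lambda>x. f x * g x) has_derivative
      (\<lambda>v. f x * frechet_derivative g (at x) v + frechet_derivative f (at x) v * g x)) (at x)"
    using assms by (intro has_derivative_mult) (auto simp: frechet_derivative_works)
  from frechet_derivative_at[OF this] show ?thesis
    by metis
qed

lemma k_times_cont_diff_mult:
  fixes f g :: "'a::real_normed_vector \<Rightarrow> 'b::real_normed_algebra"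
  shows "k_times_cont_diff k f \<Longrightarrow> k_times_cont_diff k g \<Longrightarrow> k_times_cont_diff k (\<lambda>x. f x * g x)"
proof (induction k arbitrary: f g)
  case 0
  then show ?case by (simp add: continuous_on_mult)
next
  case (Suc k)
  \<comment> \<open>The product rule leaves one factor of each summand undifferentiated, so the
    induction hypothesis must also be fed \<open>f\<close> and \<open>g\<close> themselves at order
    \<open>k\<close>, one below the given order.\<close>
  have "k_times_cont_diff k f" "k_times_cont_diff k g"
    using Suc.prems by (simp_all only: k_times_cont_diff_Suc_imp)
  with Suc show ?case
    by (simp add: differentiable_mult frechet_derivative_mult k_times_cont_diff_add)
qed

lemma smooth_const [simp]: "smooth (\<lambda>x. c)"
  by (simp add: smooth_def)

lemma smooth_add: "smooth f \<Longrightarrow> smooth g \<Longrightarrow> smooth (\<lambda>x. f x + g x)"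
  by (simp add: smooth_def k_times_cont_diff_add)

lemma smooth_mult:
  fixes f g :: "'a::real_normed_vector \<Rightarrow> 'b::real_normed_algebra"
  shows "smooth f \<Longrightarrow> smooth g \<Longrightarrow> smooth (\<lambda>x. f x * g x)"
  by (simp add: smooth_def k_times_cont_diff_mult)

lemma smooth_imp_differentiable: "smooth f \<Longrightarrow> f differentiable (at x)"
  unfolding smooth_def by (metis k_times_cont_diff.simps(2))

lemma smooth_frechet_derivative: "smooth f \<Longrightarrow> smooth (\<lambda>x. frechet_derivative f (at x) v)"
  unfolding smooth_def by (metis k_times_cont_diff.simps(2))

text \<open>Each directional derivative of \<open>exp (L x)\<close> is the function itself times the
  constant \<open>L v\<close>. Regularity of order \<open>k\<close> therefore passes to order
  \<open>k + 1\<close>, starting from continuity.\<close>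

lemma smooth_exp_linear:
  fixes L :: "'a::real_normed_vector \<Rightarrow> 'b::{banach,real_normed_field}"
  assumes "bounded_linear L"
  shows "smooth (\<lambda>x. exp (L x))"
proof -
  have D: "((\<lambda>x. exp (L x)) has_derivative (\<lambda>v. L v * exp (L x))) (at x)" for x
    using has_derivative_compose[OF bounded_linear_imp_has_derivative[OF assms]
        DERIV_exp[unfolded has_field_derivative_def]]
    by (simp add: mult.commute)
  have "frechet_derivative (\<lambda>x. exp (L x)) (at x) v = L v * exp (L x)" for x v
    using frechet_derivative_at[OF D] by metis
  moreover have "(\<lambda>x. exp (L x)) differentiable (at x)" for x
    using D differentiable_def by blast
  moreover have "continuous_on UNIV (\<lambda>x. exp (L x))"
    using assms by (intro continuous_on_exp linear_continuous_on)
  ultimately have "k_times_cont_diff k (\<lambda>x. exp (L x))" for k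
    by (induction k) (simp_all add: k_times_cont_diff_mult)
  then show ?thesis
    by (simp add: smooth_def)
qed

section \<open>The derivative in s as a directional derivative\<close>

lemma partial_s_frechet:
  assumes "f differentiable (at p)"
  shows "partial_s f p = frechet_derivative f (at p) (1, 0)"
proof (cases p)
  case (Pair s t)
  obtain D where D: "(f has_derivative D) (at (s, t))"
    using assms Pair unfolding differentiable_def by blast
  then interpret D: bounded_linear D by (rule has_derivative_bounded_linear)
  have "((\<lambda>u. f (u, t)) has_vector_derivative D (1, 0)) (at s)"
    unfolding has_vector_derivative_def
    \<comment> \<open>The chain rule along u -> (u, t) produces the derivative h ->
      \<open>D (h, 0)\<close>; linearity of \<open>D\<close> turns this into h times
      \<open>D (1, 0)\<close>.\<close>
    by (rule has_derivative_eq_rhs[OF has_derivative_compose[where g = f and g' = D]])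
       (auto intro!: derivative_eq_intros D simp: D.scaleR[symmetric])
  then show ?thesis
    using frechet_derivative_at[OF D] Pair by (simp add: partial_s_def vector_derivative_at)
qed

lemma smooth_partial_s: "smooth f \<Longrightarrow> smooth (partial_s f)"
proof -
  assume f: "smooth f"
  then have "partial_s f = (\<lambda>x. frechet_derivative f (at x) (1, 0))"
    by (auto simp: partial_s_frechet smooth_imp_differentiable)
  with f show ?thesis
    by (simp add: smooth_frechet_derivative)
qed

lemma partial_s_add:
  "smooth f \<Longrightarrow> smooth g \<Longrightarrow> partial_s (\<lambda>x. f x + g x) p = partial_s f p + partial_s g p"
  by (simp only: partial_s_frechet[OF smooth_imp_differentiable] smooth_add
      frechet_derivative_add[OF smooth_imp_differentiable smooth_imp_differentiable])

lemma partial_s_mult: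
  "smooth f \<Longrightarrow> smooth g \<Longrightarrow>
    partial_s (\<lambda>x. f x * g x) p = f p * partial_s g p + partial_s f p * g p"
  by (simp only: partial_s_frechet[OF smooth_imp_differentiable] smooth_mult
      frechet_derivative_mult[OF smooth_imp_differentiable smooth_imp_differentiable])

lemma partial_s_const [simp]: "partial_s (\<lambda>x. c) p = 0"
  by (simp add: partial_s_def split: prod.split)

text \<open>The parameter \<open>c\<close> covers e^s and e^(-s) at once, as the cases 1 and -1;
  these are the only non-constant functions among the coefficients.\<close>

lemma smooth_exp_fst: "smooth (\<lambda>p::real \<times> real. exp (complex_of_real (c * fst p)))"
  by (intro smooth_exp_linear bounded_linear_compose[OF bounded_linear_of_real]
      bounded_linear_compose[OF bounded_linear_mult_right] bounded_linear_fst)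

lemma partial_s_exp_fst:
  "partial_s (\<lambda>p. exp (complex_of_real (c * fst p))) p = of_real c * exp (of_real (c * fst p))"
proof (cases p)
  case (Pair s t)
  have "((\<lambda>u. exp (complex_of_real (c * u))) has_vector_derivative
      of_real c * exp (of_real (c * s))) (at s)"
    by (auto intro!: derivative_eq_intros simp: has_vector_derivative_def scaleR_conv_of_real
        has_field_derivative_def exp_of_real simp flip: of_real_mult)
  then show ?thesis
    by (simp add: Pair partial_s_def vector_derivative_at)
qed

section \<open>Supports and the space of test functions\<close>

lemma zero_outside_support: "p \<notin> closure (support_on UNIV f) \<Longrightarrow> f p = 0"
  using closure_subset[of "support_on UNIV f"] by (auto simp: support_on_def)

text \<open>The complement of the closed support is open and \<open>f\<close> vanishes on it, so
  near \<open>p\<close> the function agrees with the zero function and inherits its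
  derivative.\<close>

lemma partial_s_support:
  assumes "p \<notin> closure (support_on UNIV f)"
  shows "partial_s f p = 0"
proof -
  let ?U = "- closure (support_on UNIV f)"
  have "(f has_derivative (\<lambda>v. 0)) (at p)"
    by (rule has_derivative_transform_within_open[of "\<lambda>x. 0" _ _ _ ?U])
       (use assms in \<open>auto simp: zero_outside_support\<close>)
  then have "f differentiable (at p)" "frechet_derivative f (at p) = (\<lambda>v. 0)"
    by (auto simp: differentiable_def frechet_derivative_at[symmetric])
  then show ?thesis
    by (simp add: partial_s_frechet)
qed

lemma test_functionsD: "f \<in> test_functions \<Longrightarrow> smooth f"
  by (simp add: test_functions_def)

text \<open>A closed subset of a compact set is compact. The set \<open>K\<close> may be larger than
  the support, so the supports of the input functions can serve for sums, multiples and derivatives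
  without computing the new support.\<close>

lemma test_functionsI:
  assumes "smooth f" "compact K" "\<And>p. p \<notin> K \<Longrightarrow> f p = 0"
  shows "f \<in> test_functions"
proof -
  have "closure (support_on UNIV f) \<subseteq> K"
    using assms by (intro closure_minimal compact_imp_closed) (auto simp: support_on_def)
  then have "compact (closure (support_on UNIV f))"
    using assms(2) by (metis closed_closure compact_Int_closed inf.absorb2)
  with assms(1) show ?thesis
    by (simp add: test_functions_def)
qed

lemma subspace_test_functions: "module.subspace fscale test_functions"
proof -
  interpret vector_space fscale by (rule vector_space_fscale)
  show ?thesis
  proof (rule subspaceI)
    show "0 \<in> test_functions"
      by (rule test_functionsI[of _ "{}"]) (simp_all add: zero_fun_def)
  next
    fix f g assume f: "f \<in> test_functions" and g: "g \<in> test_functions"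
    show "f + g \<in> test_functions"
    proof (rule test_functionsI)
      show "smooth (f + g)"
        using f g smooth_add[of f g] by (simp add: test_functions_def plus_fun_def)
      show "compact (closure (support_on UNIV f) \<union> closure (support_on UNIV g))"
        using f g by (auto simp: test_functions_def)
      show "(f + g) p = 0" if "p \<notin> closure (support_on UNIV f) \<union> closure (support_on UNIV g)" for p
        using that by (simp add: plus_fun_def zero_outside_support)
    qed
  next
    fix z f assume f: "f \<in> test_functions"
    show "fscale z f \<in> test_functions"
    proof (rule test_functionsI)
      show "smooth (fscale z f)"
        using f smooth_mult[of "\<lambda>x. z" f] by (simp add: test_functions_def fscale_def)
      show "compact (closure (support_on UNIV f))"
        using f by (simp add: test_functions_def)
      show "fscale z f p = 0" if "p \<notin> closure (support_on UNIV f)" for p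
        using that by (simp add: fscale_def zero_outside_support)
    qed
  qed
qed

section \<open>First-order operators in s and their commutators\<close>

definition first_order ::
  "(real \<times> real \<Rightarrow> complex) \<Rightarrow> (real \<times> real \<Rightarrow> complex) \<Rightarrow>
    (real \<times> real \<Rightarrow> complex) \<Rightarrow> real \<times> real \<Rightarrow> complex" where
  "first_order P M f = (\<lambda>x. P x * partial_s f x + M x * f x)"

lemma first_order_test_functions:
  assumes "smooth P" "smooth M" and f: "f \<in> test_functions"
  shows "first_order P M f \<in> test_functions"
proof (rule test_functionsI)
  show "smooth (first_order P M f)"
    unfolding first_order_def
    using assms by (intro smooth_add smooth_mult smooth_partial_s) (auto dest: test_functionsD)
  show "compact (closure (support_on UNIV f))"
    using f by (simp add: test_functions_def)
  show "first_order P M f p = 0" if "p \<notin> closure (support_on UNIV f)" for p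
    using that by (simp add: first_order_def partial_s_support zero_outside_support)
qed

lemma first_order_add:
  "smooth f \<Longrightarrow> smooth g \<Longrightarrow> first_order P M (f + g) = first_order P M f + first_order P M g"
  by (simp add: first_order_def fun_eq_iff plus_fun_def partial_s_add algebra_simps)

lemma first_order_fscale:
  "smooth f \<Longrightarrow> first_order P M (fscale z f) = fscale z (first_order P M f)"
  by (simp add: first_order_def fun_eq_iff fscale_def partial_s_mult algebra_simps)

text \<open>Expanding both compositions by the product rule, the second-order terms with P Q, the
  terms with P N and Q M times the derivative of f, and the terms M N f each occur in both and
  cancel. Only the terms in which a coefficient is differentiated survive.\<close>

lemma first_order_commutator:
  assumes "smooth P" "smooth M" "smooth Q" "smooth N" "smooth f"
  shows "first_order P M (first_order Q N f) - first_order Q N (first_order P M f) =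
    first_order (\<lambda>x. P x * partial_s Q x - Q x * partial_s P x)
      (\<lambda>x. P x * partial_s N x - Q x * partial_s M x) f"
  using assms
  by (simp add: first_order_def fun_eq_iff partial_s_add partial_s_mult smooth_mult
      smooth_partial_s algebra_simps)

section \<open>The common form of the five families\<close>

fun symbol1 :: "real \<Rightarrow> diamond \<Rightarrow> real \<times> real \<Rightarrow> complex" where
  "symbol1 p (a, b, c, d) = (\<lambda>x. of_real d + of_real (b * p) * exp (of_real (1 * fst x)))"

text \<open>Here and in \<open>symbol1\<close> the exponents are written \<open>1 * fst x\<close>
  and \<open>- 1 * fst x\<close>, so that they are literal instances of
  \<open>smooth_exp_fst\<close>. The coefficient \<open>p * u\<close> of \<open>c\<close> is the
  value produced by X and Y: -p e^s times the derivative -i u e^(-s) equals the constant i p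
  u.\<close>

fun symbol0 :: "real \<Rightarrow> real \<Rightarrow> real \<Rightarrow> diamond \<Rightarrow> real \<times> real \<Rightarrow> complex" where
  "symbol0 p u v (a, b, c, d) = (\<lambda>x.
     \<i> * of_real (a * u) * exp (of_real (- 1 * fst x))
     + \<i> * of_real (b * v) * exp (of_real (1 * fst x)) + \<i> * of_real (c * p * u))"

lemma smooth_symbol1: "smooth (symbol1 p A)"
  by (cases A) (simp only: symbol1.simps smooth_add smooth_mult smooth_const smooth_exp_fst)

lemma smooth_symbol0: "smooth (symbol0 p u v A)"
  by (cases A) (simp only: symbol0.simps smooth_add smooth_mult smooth_const smooth_exp_fst)

lemma partial_s_symbol1:
  "partial_s (symbol1 p (a, b, c, d)) x = of_real (b * p) * exp (of_real (fst x))"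
  using smooth_exp_fst[of 1] partial_s_exp_fst[of 1]
  by (simp add: partial_s_add partial_s_mult smooth_mult)

lemma partial_s_symbol0:
  "partial_s (symbol0 p u v (a, b, c, d)) x =
    - \<i> * of_real (a * u) * exp (- of_real (fst x)) + \<i> * of_real (b * v) * exp (of_real (fst x))"
  using smooth_exp_fst[of 1] partial_s_exp_fst[of 1] smooth_exp_fst[of "-1"] partial_s_exp_fst[of "-1"]
  by (simp add: partial_s_add partial_s_mult smooth_mult smooth_add)

definition diamond_op :: "real \<Rightarrow> real \<Rightarrow> real \<Rightarrow> diamond \<Rightarrow>
    (real \<times> real \<Rightarrow> complex) \<Rightarrow> real \<times> real \<Rightarrow> complex" where
  "diamond_op p u v A = first_order (symbol1 p A) (symbol0 p u v A)"

lemma diamond_op_bracket: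
  assumes "smooth f"
  shows "diamond_op p u v A (diamond_op p u v B f) - diamond_op p u v B (diamond_op p u v A f) =
    diamond_op p u v (diamond_bracket A B) f"
proof -
  obtain a b c d where A: "A = (a, b, c, d)" by (cases A)
  obtain a' b' c' d' where B: "B = (a', b', c', d')" by (cases B)
  \<comment> \<open>The coefficient p e^s of the derivative meets the derivative of e^(-s); this
    relation turns their product into the constant term that represents Z.\<close>
  have inv: "exp (complex_of_real s) * exp (- complex_of_real s) = 1" for s
    by (simp flip: exp_add)
  \<comment> \<open>The e^(2s) terms are symmetric in A and B and cancel, leaving (d b' - d' b) p
    e^s; no constant remains, in agreement with the vanishing T-coordinate of a bracket.\<close>
  have "symbol1 p A x * partial_s (symbol1 p B) x - symbol1 p B x * partial_s (symbol1 p A) x =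
      symbol1 p (diamond_bracket A B) x" for x
    unfolding A B partial_s_symbol1 by (simp add: algebra_simps)
  \<comment> \<open>Coefficients are compared: e^(-s) gives (d' a - d a') u, e^s gives (d b' - d' b)
    v, the constant gives (a b' - a' b) p u, and the e^(2s) terms cancel again.\<close>
  moreover have "symbol1 p A x * partial_s (symbol0 p u v B) x
      - symbol1 p B x * partial_s (symbol0 p u v A) x = symbol0 p u v (diamond_bracket A B) x" for x
    unfolding A B partial_s_symbol0 using inv[of "fst x"]
    by (simp, algebra)
  ultimately show ?thesis
    unfolding diamond_op_def
    by (simp add: first_order_commutator smooth_symbol1 smooth_symbol0 assms)
qed

section \<open>The representation axioms on test functions\<close>

lemma lie_representation_diamond_op:
  "lie_representation diamond_bracket fscale test_functions (diamond_op p u v)"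
proof -
  interpret real_lie_algebra diamond_bracket by (rule real_lie_algebra_diamond)
  interpret vector_space fscale by (rule vector_space_fscale)
  show ?thesis
  proof
    show "subspace test_functions"
      by (rule subspace_test_functions)
  next
    fix f A assume "f \<in> test_functions"
    then show "diamond_op p u v A f \<in> test_functions"
      by (simp add: diamond_op_def first_order_test_functions smooth_symbol1 smooth_symbol0)
  next
    fix f g A assume "f \<in> test_functions" "g \<in> test_functions"
    then show "diamond_op p u v A (f + g) = diamond_op p u v A f + diamond_op p u v A g"
      by (simp add: diamond_op_def first_order_add test_functionsD)
  next
    fix f A z assume "f \<in> test_functions"
    then show "diamond_op p u v A (fscale z f) = fscale z (diamond_op p u v A f)"
      by (simp add: diamond_op_def first_order_fscale test_functionsD)
  next
    \<comment> \<open>Both symbols are linear in the coordinates of the Lie algebra element, so this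
      axiom and the next are pointwise identities.\<close>
    fix f A B
    show "diamond_op p u v (A + B) f = diamond_op p u v A f + diamond_op p u v B f"
      by (cases A; cases B) (simp add: diamond_op_def first_order_def fun_eq_iff algebra_simps)
  next
    fix f r A
    show "diamond_op p u v (r *\<^sub>R A) f = fscale (complex_of_real r) (diamond_op p u v A f)"
      by (cases A) (simp add: diamond_op_def first_order_def fscale_def fun_eq_iff algebra_simps)
  next
    fix f A B assume "f \<in> test_functions"
    then show "diamond_op p u v A (diamond_op p u v B f) - diamond_op p u v B (diamond_op p u v A f) =
        diamond_op p u v (diamond_bracket A B) f"
      by (simp add: diamond_op_bracket test_functionsD)
  qed
qed

text \<open>For \<gamma> = 0 the choice p = 0 removes e^s from the derivative term and makes Z act
  by zero. In the last two families p u = \<gamma>: changing the signs of p, u and v together leaves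
  the coefficient of c unchanged, which is why \<open>ell5'\<close> keeps
  \<open>+ c * \<gamma>\<close>.\<close>

lemma ell_eq_diamond_op:
  "ell2 \<alpha> = diamond_op 0 \<alpha> 0"
  "ell3 \<beta> = diamond_op 0 0 \<beta>"
  "ell4 \<alpha> \<beta> = diamond_op 0 \<alpha> \<beta>"
  "ell5 \<alpha> \<beta> \<gamma> \<delta> = diamond_op \<gamma> 1 (\<alpha> * \<beta> - \<gamma> * \<delta>)"
  "ell5' \<alpha> \<beta> \<gamma> \<delta> = diamond_op (- \<gamma>) (- 1) (- (\<alpha> * \<beta> - \<gamma> * \<delta>))"
  by (auto simp: fun_eq_iff diamond_op_def first_order_def algebra_simps simp flip: exp_of_real)

theorem theorem4p6:
  fixes \<alpha> \<beta> \<gamma> \<delta> :: real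
    and ell :: "diamond \<Rightarrow> (real \<times> real \<Rightarrow> complex) \<Rightarrow> real \<times> real \<Rightarrow> complex"
  assumes "(\<alpha> \<noteq> 0 \<and> \<beta> = 0 \<and> \<gamma> = 0 \<and> ell = ell2 \<alpha>) \<or>
           (\<beta> \<noteq> 0 \<and> \<alpha> = 0 \<and> \<gamma> = 0 \<and> ell = ell3 \<beta>) \<or>
           (\<alpha> * \<beta> \<noteq> 0 \<and> \<gamma> = 0 \<and> ell = ell4 \<alpha> \<beta>) \<or>
           (\<gamma> \<noteq> 0 \<and> ell = ell5 \<alpha> \<beta> \<gamma> \<delta>) \<or>
           (\<gamma> \<noteq> 0 \<and> ell = ell5' \<alpha> \<beta> \<gamma> \<delta>)"
  shows "lie_representation diamond_bracket fscale test_functions ell \<and>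
    (\<forall>A B. \<forall>f\<in>test_functions.
       (ell A \<circ> ell B) f - (ell B \<circ> ell A) f = ell (diamond_bracket A B) f)"
proof -
  \<comment> \<open>Each of the five cases supplies its own triple, after which a single argument
    for \<open>diamond_op\<close> settles them all.\<close>
  obtain p u v where ell: "ell = diamond_op p u v"
    using assms unfolding ell_eq_diamond_op by blast
  show ?thesis
    unfolding ell by (simp add: lie_representation_diamond_op diamond_op_bracket test_functionsD)
qed

end
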